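(* Consider the two-period setting described in the context. Assume: (Irreversible treatment) $D_{i,1}=1\implies D_{i,2}=1$ almost surely. (Exclusion) For each $z\in\{0,1\}$, $Y_{i,t}(0,z)=Y_{i,t}(0)$ and $Y_{i,t}(1,0,z)=Y_{i,t}(1,0)$ for $t\in\{1,2\}$, and $Y_{i,2}(1,1,z)=Y_{i,2}(1,1)$ (that is, potential outcomes do not depend on $z$). (Independence) $\big(Y_{i,1}(0),Y_{i,1}(1,0),Y_{i,2}(0),Y_{i,2}(1,0),Y_{i,2}(1,1),D_{i,1}(1),D_{i,1}(0),D_{i,2}(1),D_{i,2}(0)\big)$ is independent of $Z_i$. (Relevance at $t=1$) $FS_1\neq 0$. (Monotonicity at $t=1$) $\mathbb{P}(F_1)=0$. If $FS_2\neq 0$, then $RF_2/FS_2$ is a linear combination of the causal effects $\Delta_2^1(C_1)$, $\Delta_2^0(C_1,AT_2)$, $\Delta_2^0(NT_1,F_2)$, $\Delta_2^0(NT_1,C_2)$, with respective weights $$\frac{\mathbb{P}(C_1)}{FS_2},\quad -\frac{\mathbb{P}(C_1,AT_2)}{FS_2},\quad -\frac{\mathbb{P}(NT_1,F_2)}{FS_2},\quad \frac{\mathbb{P}(NT_1,C_2)}{FS_2},$$ and these weights sum to one, but some of them may be negative (the assumptions do not guarantee that they are all nonnegative). At least one of these weights must be negative whenever $FS_2<FS_1$. Moreover, the causal effects that are negatively weighted in $RF_2/FS_2$ are the same as those that are negatively weighted in $RF_2$ (where the respective weights are $\mathbb{P}(C_1)$, $-\mathbb{P}(C_1,AT_2)$,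 $-\mathbb{P}(NT_1,F_2)$, $\mathbb{P}(NT_1,C_2)$) if, and only if, $FS_2>0$.
   Context: Setting. Time is $t\in\{1,2\}$; $i$ denotes a generic observation. $Z_i\in\{0,1\}$ is a time-invariant binary instrument with $0<\mathbb{P}(Z_i=1)<1$. $D_{i,t}(z)\in\{0,1\}$ is the potential treatment status at $t$ under instrument value $z$, and the observed status is $D_{i,t}=D_{i,t}(Z_i)$. No unit is treated before period 1. $Y_{i,t}(0,z)$ is the potential outcome at $t$ if $i$ has not been treated up to $t$ and the instrument is $z$; $Y_{i,t}(1,\tau,z)$, $\tau\in\{0,\dots,t-1\}$, is the potential outcome at $t$ if $i$ is first treated at period $t-\tau$ and the instrument is $z$. The observed outcome $Y_{i,t}$ equals $Y_{i,t}(0,Z_i)$ if $i$ has not been treated up to $t$, and $Y_{i,t}(1,t-s,Z_i)$ if $i$ was first treated at $s\le t$. All expectations written are assumed to exist (one may take all potential outcomes to be integrable). Latent types at $t$ (events): $AT_t=\{D_{i,t}(1)=D_{i,t}(0)=1\}$, $C_t=\{D_{i,t}(1)>D_{i,t}(0)\}$, $F_t=\{D_{i,t}(1)<D_{i,t}(0)\}$, $NT_t=\{D_{i,t}(1)=D_{i,t}(0)=0\}$. A pair such as $(C_1,AT_2)$ denotes the intersection $C_1\cap AT_2$. Estimands: $RF_t=\mathbb{E}[Y_{i,t}\mid Z_i=1]-\mathbb{E}[Y_{i,t}\mid Z_i=0]$ and $FS_t=\mathbb{E}[D_{i,t}\mid Z_i=1]-\mathbb{E}[D_{i,t}\mid Z_i=0]$.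 Causal effects (under exclusion): for a latent group $g$, $\Delta_t^\tau(g)=\mathbb{E}[Y_{i,t}(1,\tau)-Y_{i,t}(0)\mid g]$. A product of $\Delta_t^\tau(g)$ with a weight that is zero because $\mathbb{P}(g)=0$ is read as $0$. *)

theory Defs
  imports "HOL-Probability.Probability"
begin

text \<open>
  A two-period instrumental-variable model.  Times are the naturals 1 and 2 (no other value of the
  time argument is ever constrained), and the values 0 and 1 of the instrument and of the treatment
  are \<open>False\<close> and \<open>True\<close>.

  \<open>potD t z\<close> is the potential treatment \<open>D_t(z)\<close>, \<open>potY0z t z\<close> is \<open>Y_t(0,z)\<close> and
  \<open>potY1z t tau z\<close> is \<open>Y_t(1,tau,z)\<close>.  The fields \<open>potY0 t\<close> and \<open>potY1 t tau\<close> are the outcomes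
  \<open>Y_t(0)\<close> and \<open>Y_t(1,tau)\<close> without instrument argument; they are tied to the previous ones only by
  the exclusion restriction.
\<close>

record 'a iv_model =
  pspace :: "'a measure"
  instr  :: "'a \<Rightarrow> bool"
  potD   :: "nat \<Rightarrow> bool \<Rightarrow> 'a \<Rightarrow> bool"
  potY0z :: "nat \<Rightarrow> bool \<Rightarrow> 'a \<Rightarrow> real"
  potY1z :: "nat \<Rightarrow> nat \<Rightarrow> bool \<Rightarrow> 'a \<Rightarrow> real"
  potY0  :: "nat \<Rightarrow> 'a \<Rightarrow> real"
  potY1  :: "nat \<Rightarrow> nat \<Rightarrow> 'a \<Rightarrow> real"

abbreviation Pr :: "'a iv_model \<Rightarrow> 'a set \<Rightarrow> real" where
  "Pr m \<equiv> measure (pspace m)"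

definition obsD :: "'a iv_model \<Rightarrow> nat \<Rightarrow> 'a \<Rightarrow> bool" where
  "obsD m t \<omega> = potD m t (instr m \<omega>) \<omega>"

definition obsY :: "'a iv_model \<Rightarrow> nat \<Rightarrow> 'a \<Rightarrow> real" where
  "obsY m t \<omega> =
     (if \<exists>s\<in>{1..t}. obsD m s \<omega>
      then potY1z m t (t - (LEAST s. 1 \<le> s \<and> obsD m s \<omega>)) (instr m \<omega>) \<omega>
      else potY0z m t (instr m \<omega>) \<omega>)"

text \<open>Latent types; the order on \<^typ>\<open>bool\<close> is \<^prop>\<open>False < True\<close>.\<close>

definition AT :: "'a iv_model \<Rightarrow> nat \<Rightarrow> 'a set" where
  "AT m t = {\<omega> \<in> space (pspace m). potD m t True \<omega> \<and> potD m t False \<omega>}"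

definition CO :: "'a iv_model \<Rightarrow> nat \<Rightarrow> 'a set" where
  "CO m t = {\<omega> \<in> space (pspace m). potD m t True \<omega> > potD m t False \<omega>}"

definition DF :: "'a iv_model \<Rightarrow> nat \<Rightarrow> 'a set" where
  "DF m t = {\<omega> \<in> space (pspace m). potD m t True \<omega> < potD m t False \<omega>}"

definition NT :: "'a iv_model \<Rightarrow> nat \<Rightarrow> 'a set" where
  "NT m t = {\<omega> \<in> space (pspace m). \<not> potD m t True \<omega> \<and> \<not> potD m t False \<omega>}"

text \<open>
  Conditional expectation given an event.  For an event of probability zero it is 0, so that its
  product with a zero weight is 0.
\<close>

definition cexp :: "'a iv_model \<Rightarrow> ('a \<Rightarrow> real) \<Rightarrow> 'a set \<Rightarrow> real" where
  "cexp m X A = (LINT \<omega>:A|pspace m. X \<omega>) / Pr m A"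

definition Zev :: "'a iv_model \<Rightarrow> bool \<Rightarrow> 'a set" where
  "Zev m z = {\<omega> \<in> space (pspace m). instr m \<omega> = z}"

definition RF :: "'a iv_model \<Rightarrow> nat \<Rightarrow> real" where
  "RF m t = cexp m (obsY m t) (Zev m True) - cexp m (obsY m t) (Zev m False)"

definition FS :: "'a iv_model \<Rightarrow> nat \<Rightarrow> real" where
  "FS m t = cexp m (\<lambda>\<omega>. of_bool (obsD m t \<omega>)) (Zev m True)
          - cexp m (\<lambda>\<omega>. of_bool (obsD m t \<omega>)) (Zev m False)"

definition \<Delta> :: "'a iv_model \<Rightarrow> nat \<Rightarrow> nat \<Rightarrow> 'a set \<Rightarrow> real" where
  "\<Delta> m t \<tau> g = cexp m (\<lambda>\<omega>. potY1 m t \<tau> \<omega> - potY0 m t \<omega>) g"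

definition iv_setting :: "'a iv_model \<Rightarrow> bool" where
  "iv_setting m \<longleftrightarrow>
     prob_space (pspace m) \<and>
     instr m \<in> measurable (pspace m) (count_space UNIV) \<and>
     0 < Pr m (Zev m True) \<and> Pr m (Zev m True) < 1 \<and>
     (\<forall>t\<in>{1,2}. \<forall>z.
        potD m t z \<in> measurable (pspace m) (count_space UNIV) \<and>
        integrable (pspace m) (potY0z m t z) \<and>
        (\<forall>\<tau><t. integrable (pspace m) (potY1z m t \<tau> z)))"

definition irreversible :: "'a iv_model \<Rightarrow> bool" where
  "irreversible m \<longleftrightarrow> (AE \<omega> in pspace m. obsD m 1 \<omega> \<longrightarrow> obsD m 2 \<omega>)"

text \<open>Equality of potential outcomes is equality of random variables, i.e. almost sure equality.\<close>

definition exclusion :: "'a iv_model \<Rightarrow> bool" where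
  "exclusion m \<longleftrightarrow> (\<forall>z.
     (\<forall>t\<in>{1,2}. (AE \<omega> in pspace m. potY0z m t z \<omega> = potY0 m t \<omega>) \<and>
                (AE \<omega> in pspace m. potY1z m t 0 z \<omega> = potY1 m t 0 \<omega>)) \<and>
     (AE \<omega> in pspace m. potY1z m 2 1 z \<omega> = potY1 m 2 1 \<omega>))"

text \<open>
  Independence of two random variables with values in different types (\<open>indep_var\<close> wants a common
  value type): the events they generate are independent.
\<close>

definition indep_rv :: "'a measure \<Rightarrow> 'b measure \<Rightarrow> ('a \<Rightarrow> 'b) \<Rightarrow> 'c measure \<Rightarrow> ('a \<Rightarrow> 'c) \<Rightarrow> bool" where
  "indep_rv M S X T Y \<longleftrightarrow>
     X \<in> measurable M S \<and> Y \<in> measurable M T \<and>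
     prob_space.indep_set M {X -` A \<inter> space M | A. A \<in> sets S} {Y -` B \<inter> space M | B. B \<in> sets T}"

definition independence :: "'a iv_model \<Rightarrow> bool" where
  "independence m \<longleftrightarrow>
     indep_rv (pspace m)
       (borel \<Otimes>\<^sub>M borel \<Otimes>\<^sub>M borel \<Otimes>\<^sub>M borel \<Otimes>\<^sub>M borel \<Otimes>\<^sub>M
          count_space UNIV \<Otimes>\<^sub>M count_space UNIV \<Otimes>\<^sub>M count_space UNIV \<Otimes>\<^sub>M count_space UNIV)
       (\<lambda>\<omega>. (potY0 m 1 \<omega>, potY1 m 1 0 \<omega>, potY0 m 2 \<omega>, potY1 m 2 0 \<omega>, potY1 m 2 1 \<omega>,
             potD m 1 True \<omega>, potD m 1 False \<omega>, potD m 2 True \<omega>, potD m 2 False \<omega>))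
       (count_space UNIV) (instr m)"

definition iv_assumptions :: "'a iv_model \<Rightarrow> bool" where
  "iv_assumptions m \<longleftrightarrow>
     iv_setting m \<and> irreversible m \<and> exclusion m \<and> independence m \<and>
     FS m 1 \<noteq> 0 \<and> Pr m (DF m 1) = 0"

text \<open>
  Labels for the four causal effects of the decomposition.  Which effects are negatively weighted
  is a statement about these labels, not about the numerical values of the effects.
\<close>

datatype effect = Eff_C1 | Eff_C1_AT2 | Eff_NT1_F2 | Eff_NT1_C2

fun causal_effect :: "'a iv_model \<Rightarrow> effect \<Rightarrow> real" where
  "causal_effect m Eff_C1     = \<Delta> m 2 1 (CO m 1)"
| "causal_effect m Eff_C1_AT2 = \<Delta> m 2 0 (CO m 1 \<inter> AT m 2)"
| "causal_effect m Eff_NT1_F2 = \<Delta> m 2 0 (NT m 1 \<inter> DF m 2)"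
| "causal_effect m Eff_NT1_C2 = \<Delta> m 2 0 (NT m 1 \<inter> CO m 2)"

fun RF_weight :: "'a iv_model \<Rightarrow> effect \<Rightarrow> real" where
  "RF_weight m Eff_C1     = Pr m (CO m 1)"
| "RF_weight m Eff_C1_AT2 = - Pr m (CO m 1 \<inter> AT m 2)"
| "RF_weight m Eff_NT1_F2 = - Pr m (NT m 1 \<inter> DF m 2)"
| "RF_weight m Eff_NT1_C2 = Pr m (NT m 1 \<inter> CO m 2)"

definition Wald_weight :: "'a iv_model \<Rightarrow> effect \<Rightarrow> real" where
  "Wald_weight m e = RF_weight m e / FS m 2"

end

(* Independence of Z turns E[. | Z = z] into an unconditional expectation of the outcome under
   instrument value z, so RF_2 is the mean of the unit-level difference between z = 1 and z = 0.
   Irreversibility passes from the observed to the potential treatments (D_1(z) = 1 implies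
   D_2(z) = 1, for both z), and without period-1 defiers the difference then splits over the latent
   types: always takers at 1 contribute 0, compliers contribute Y(1,1) - Y(0) minus the effect of
   late treatment for those treated at 2 anyway, and never takers at 1 contribute as in a one-period
   model.  FS_2 is the same expression with all effects equal to 1, which gives the sum of the
   weights; FS_1 = P(C_1) is the strictly positive weight that controls the signs. *)

theory Submission imports Defs begin

section \<open>Independence and conditional expectation in general\<close>

text \<open>The set integral is the expectation of
  \<open>f (X \<omega>) * indicator B (Y \<omega>)\<close>. Both factors are real valued, so
  \<open>indep_var\<close> and its product rule apply to them although \<open>X\<close> and
  \<open>Y\<close> have different value types.\<close>

lemma (in prob_space) indep_rv_set_integral:
  fixes f :: "'b \<Rightarrow> real"
  assumes "indep_rv M S X T Y"
    and f [measurable]: "f \<in> borel_measurable S"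
    and int: "integrable M (\<lambda>\<omega>. f (X \<omega>))"
    and B [measurable]: "B \<in> sets T"
  shows "(LINT \<omega>:Y -` B \<inter> space M|M. f (X \<omega>)) = prob (Y -` B \<inter> space M) * expectation (\<lambda>\<omega>. f (X \<omega>))"
proof -
  have X [measurable]: "X \<in> measurable M S" and Y [measurable]: "Y \<in> measurable M T"
    and ind: "indep_set {X -` A \<inter> space M | A. A \<in> sets S} {Y -` B \<inter> space M | B. B \<in> sets T}"
    using assms(1) by (auto simp: indep_rv_def)
  \<comment> \<open>Independence of generators extends to the generated sigma algebras, as
    \<open>indep_var_eq\<close> demands, when the generators are closed under intersection.\<close>
  have stable: "Int_stable {U -` A \<inter> space M | A. A \<in> sets N}" for U :: "'a \<Rightarrow> 'd" and N
  proof (rule Int_stableI)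
    fix a b assume "a \<in> {U -` A \<inter> space M | A. A \<in> sets N}" "b \<in> {U -` A \<inter> space M | A. A \<in> sets N}"
    then obtain A A' where "A \<in> sets N" "A' \<in> sets N" "a = U -` A \<inter> space M" "b = U -` A' \<inter> space M"
      by auto
    then show "a \<inter> b \<in> {U -` A \<inter> space M | A. A \<in> sets N}"
      by (auto intro!: exI[of _ "A \<inter> A'"])
  qed
  define g :: "'c \<Rightarrow> real" where "g = indicator B"
  have g [measurable]: "g \<in> borel_measurable T"
    unfolding g_def by measurable
  \<comment> \<open>Events generated by \<open>h\<close> of \<open>U\<close> are among those
    generated by \<open>U\<close>, so independence passes to measurable functions.\<close>
  have sub: "{(\<lambda>\<omega>. h (U \<omega>)) -` A \<inter> space M | A. A \<in> sets borel} \<subseteq> {U -` A \<inter> space M | A. A \<in> sets N}"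
    if "h \<in> borel_measurable N" "U \<in> measurable M N" for h :: "'d \<Rightarrow> real" and U N
  proof safe
    fix A :: "real set" assume "A \<in> sets borel"
    then have "h -` A \<inter> space N \<in> sets N"
      using that by (auto intro: measurable_sets)
    moreover have "(\<lambda>\<omega>. h (U \<omega>)) -` A \<inter> space M = U -` (h -` A \<inter> space N) \<inter> space M"
      using that by (auto dest: measurable_space)
    ultimately show "\<exists>A'. (\<lambda>\<omega>. h (U \<omega>)) -` A \<inter> space M = U -` A' \<inter> space M \<and> A' \<in> sets N"
      by blast
  qed
  have "indep_set {(\<lambda>\<omega>. f (X \<omega>)) -` A \<inter> space M | A. A \<in> sets borel}
      {(\<lambda>\<omega>. g (Y \<omega>)) -` A \<inter> space M | A. A \<in> sets borel}"
  proof (rule indep_setI)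
    fix a b assume "a \<in> {(\<lambda>\<omega>. f (X \<omega>)) -` A \<inter> space M | A. A \<in> sets borel}"
      "b \<in> {(\<lambda>\<omega>. g (Y \<omega>)) -` A \<inter> space M | A. A \<in> sets borel}"
    then have "a \<in> {X -` A \<inter> space M | A. A \<in> sets S}" "b \<in> {Y -` B \<inter> space M | B. B \<in> sets T}"
      by - (erule subsetD[OF sub[OF f X]], erule subsetD[OF sub[OF g Y]])
    then show "prob (a \<inter> b) = prob a * prob b"
      by (rule indep_setD[OF ind])
  qed auto
  then have "indep_var borel (\<lambda>\<omega>. f (X \<omega>)) borel (\<lambda>\<omega>. g (Y \<omega>))"
    unfolding indep_var_eq by (auto intro!: indep_set_sigma_sets stable)
  moreover have "integrable M (\<lambda>\<omega>. g (Y \<omega>))"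
    by (rule integrable_const_bound[of _ 1]) (auto simp: g_def indicator_def)
  ultimately have "expectation (\<lambda>\<omega>. f (X \<omega>) * g (Y \<omega>)) =
      expectation (\<lambda>\<omega>. f (X \<omega>)) * expectation (\<lambda>\<omega>. g (Y \<omega>))"
    by (intro indep_var_lebesgue_integral int)
  moreover have "expectation (\<lambda>\<omega>. g (Y \<omega>)) = prob (Y -` B \<inter> space M)"
  proof -
    have "expectation (\<lambda>\<omega>. g (Y \<omega>)) = expectation (indicator (Y -` B \<inter> space M))"
      by (intro Bochner_Integration.integral_cong) (auto simp: g_def indicator_def)
    then show ?thesis by simp
  qed
  moreover have "(LINT \<omega>:Y -` B \<inter> space M|M. f (X \<omega>)) = expectation (\<lambda>\<omega>. f (X \<omega>) * g (Y \<omega>))"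
    unfolding set_lebesgue_integral_def
    by (intro Bochner_Integration.integral_cong) (auto simp: g_def indicator_def)
  ultimately show ?thesis by simp
qed

text \<open>On a null event both sides vanish, because \<open>cexp\<close> is 0 there. Weight times
  effect is thus a set integral without any case distinction on empty types.\<close>

lemma measure_times_cexp:
  assumes "prob_space (pspace m)" "A \<in> sets (pspace m)"
  shows "Pr m A * cexp m X A = (LINT \<omega>:A|pspace m. X \<omega>)"
proof (cases "Pr m A = 0")
  case True
  interpret prob_space "pspace m" by fact
  have "AE \<omega> in pspace m. \<omega> \<notin> A"
    using prob_eq_0[OF assms(2)] True by simp
  then have "(LINT \<omega>:A|pspace m. X \<omega>) = 0"
    unfolding set_lebesgue_integral_def
    by (intro integral_eq_zero_AE) (auto elim!: eventually_mono)
  with True show ?thesis by simp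
qed (simp add: cexp_def)

lemma UNIV_effect: "UNIV = {Eff_C1, Eff_C1_AT2, Eff_NT1_F2, Eff_NT1_C2}"
proof (intro set_eqI)
  show "e \<in> UNIV \<longleftrightarrow> e \<in> {Eff_C1, Eff_C1_AT2, Eff_NT1_F2, Eff_NT1_C2}" for e
    by (cases e) auto
qed

section \<open>The model: measurability, integrability, latent vector\<close>

locale iv =
  fixes m :: "'a iv_model"
  assumes setting: "iv_setting m"
    and irrev: "irreversible m"
    and excl: "exclusion m"
    and indep: "independence m"
    and mono: "Pr m (DF m 1) = 0"
begin

sublocale prob_space "pspace m"
  using setting by (simp add: iv_setting_def)

lemma measurable_instr [measurable]: "instr m \<in> measurable (pspace m) (count_space UNIV)"
  using setting by (simp add: iv_setting_def)

text \<open>The simplifier rewrites \<open>1\<close> to \<open>Suc 0\<close>, hence the second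
  form.\<close>

lemma measurable_potD [measurable]:
  "potD m 1 z \<in> measurable (pspace m) (count_space UNIV)"
  "potD m (Suc 0) z \<in> measurable (pspace m) (count_space UNIV)"
  "potD m 2 z \<in> measurable (pspace m) (count_space UNIV)"
  using setting by (simp_all add: iv_setting_def)

lemma integrable_pot_z:
  "integrable (pspace m) (potY0z m 2 z)"
  "integrable (pspace m) (potY1z m 2 0 z)"
  "integrable (pspace m) (potY1z m 2 1 z)"
  using setting by (auto simp: iv_setting_def)

lemmas measurable_pot_z [measurable] = integrable_pot_z[THEN borel_measurable_integrable]

text \<open>Naming the vector from \<open>independence\<close> lets integrands be written as
  \<open>h (latent \<omega>)\<close>. Later patterns \<open>(a,b,c,d,e,p,q,r,s)\<close> follow this
  order: \<open>c\<close>, \<open>d\<close>, \<open>e\<close> are the period-2 outcomes and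
  \<open>p\<close>, \<open>q\<close>, \<open>r\<close>, \<open>s\<close> the treatments.\<close>

definition latent :: "'a \<Rightarrow> real \<times> real \<times> real \<times> real \<times> real \<times> bool \<times> bool \<times> bool \<times> bool" where
  "latent \<omega> = (potY0 m 1 \<omega>, potY1 m 1 0 \<omega>, potY0 m 2 \<omega>, potY1 m 2 0 \<omega>, potY1 m 2 1 \<omega>,
     potD m 1 True \<omega>, potD m 1 False \<omega>, potD m 2 True \<omega>, potD m 2 False \<omega>)"

abbreviation latent_space ::
    "(real \<times> real \<times> real \<times> real \<times> real \<times> bool \<times> bool \<times> bool \<times> bool) measure" where
  "latent_space \<equiv> borel \<Otimes>\<^sub>M borel \<Otimes>\<^sub>M borel \<Otimes>\<^sub>M borel \<Otimes>\<^sub>M borel \<Otimes>\<^sub>M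
     count_space UNIV \<Otimes>\<^sub>M count_space UNIV \<Otimes>\<^sub>M count_space UNIV \<Otimes>\<^sub>M count_space UNIV"

lemma indep_latent: "indep_rv (pspace m) latent_space latent (count_space UNIV) (instr m)"
  using indep unfolding independence_def latent_def[abs_def] .

lemma measurable_latent [measurable]: "latent \<in> measurable (pspace m) latent_space"
  using indep_latent by (simp add: indep_rv_def)

text \<open>\<open>iv_setting\<close> speaks of outcomes with an instrument argument. Those without
  are projections of \<open>latent\<close>, whose measurability is part of independence.\<close>

lemma measurable_pot [measurable]:
  "potY0 m 2 \<in> borel_measurable (pspace m)"
  "potY1 m 2 0 \<in> borel_measurable (pspace m)"
  "potY1 m 2 1 \<in> borel_measurable (pspace m)"
proof -
  have "(\<lambda>\<omega>. (\<lambda>(a,b,c,d,e,r). c) (latent \<omega>)) \<in> borel_measurable (pspace m)"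
    by measurable
  then show "potY0 m 2 \<in> borel_measurable (pspace m)" by (simp add: latent_def)
  have "(\<lambda>\<omega>. (\<lambda>(a,b,c,d,e,r). d) (latent \<omega>)) \<in> borel_measurable (pspace m)"
    by measurable
  then show "potY1 m 2 0 \<in> borel_measurable (pspace m)" by (simp add: latent_def)
  have "(\<lambda>\<omega>. (\<lambda>(a,b,c,d,e,r). e) (latent \<omega>)) \<in> borel_measurable (pspace m)"
    by measurable
  then show "potY1 m 2 1 \<in> borel_measurable (pspace m)" by (simp add: latent_def)
qed

lemma AE_exclusion:
  "AE \<omega> in pspace m. potY0z m 2 z \<omega> = potY0 m 2 \<omega>"
  "AE \<omega> in pspace m. potY1z m 2 0 z \<omega> = potY1 m 2 0 \<omega>"
  "AE \<omega> in pspace m. potY1z m 2 1 z \<omega> = potY1 m 2 1 \<omega>"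
  using excl by (simp_all add: exclusion_def)

text \<open>Integrability passes from the outcomes at \<open>z = True\<close> along the almost sure
  equalities of exclusion.\<close>

lemma integrable_pot:
  "integrable (pspace m) (potY0 m 2)"
  "integrable (pspace m) (potY1 m 2 0)"
  "integrable (pspace m) (potY1 m 2 1)"
proof -
  have "integrable (pspace m) x"
    if "integrable (pspace m) y" "x \<in> borel_measurable (pspace m)" "AE \<omega> in pspace m. y \<omega> = x \<omega>"
    for x y :: "'a \<Rightarrow> real"
    using that by (rule integrable_cong_AE_imp)
  then show "integrable (pspace m) (potY0 m 2)" "integrable (pspace m) (potY1 m 2 0)"
    "integrable (pspace m) (potY1 m 2 1)"
    using integrable_pot_z[of True] measurable_pot AE_exclusion[of True] by blast+
qed

lemma sets_types [measurable]:
  "CO m 1 \<in> events" "NT m 1 \<in> events" "DF m 1 \<in> events"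
  "CO m 2 \<in> events" "AT m 2 \<in> events" "DF m 2 \<in> events"
  unfolding CO_def NT_def DF_def AT_def by measurable

lemmas sets_types_Suc [measurable] = sets_types(1-3)[unfolded One_nat_def]

section \<open>Conditioning on the instrument\<close>

lemma Zev_vimage: "Zev m z = instr m -` {z} \<inter> space (pspace m)"
  by (auto simp: Zev_def)

lemma sets_Zev [measurable]: "Zev m z \<in> events"
  unfolding Zev_def by measurable

lemma prob_Zev_pos: "0 < prob (Zev m z)"
proof (cases z)
  case False
  have "Zev m False = space (pspace m) - Zev m True"
    by (auto simp: Zev_def)
  then have "prob (Zev m False) = 1 - prob (Zev m True)"
    by (simp add: prob_compl)
  with setting False show ?thesis by (simp add: iv_setting_def)
qed (use setting in \<open>simp add: iv_setting_def\<close>)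

text \<open>The observed \<open>g\<close> need only agree with a function of the latent vector on
  the event \<open>Zev m z\<close>. Independence then factors out the positive probability of that
  event, which cancels.\<close>

lemma cexp_Zev:
  assumes "h \<in> borel_measurable latent_space"
    and "integrable (pspace m) (\<lambda>\<omega>. h (latent \<omega>))"
    and [measurable]: "g \<in> borel_measurable (pspace m)"
    and "AE \<omega> in pspace m. \<omega> \<in> Zev m z \<longrightarrow> g \<omega> = h (latent \<omega>)"
  shows "cexp m g (Zev m z) = expectation (\<lambda>\<omega>. h (latent \<omega>))"
proof -
  have "(LINT \<omega>:Zev m z|pspace m. g \<omega>) = (LINT \<omega>:Zev m z|pspace m. h (latent \<omega>))"
    using assms by (intro set_lebesgue_integral_cong_AE) auto
  also have "\<dots> = prob (Zev m z) * expectation (\<lambda>\<omega>. h (latent \<omega>))"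
    unfolding Zev_vimage by (rule indep_rv_set_integral[OF indep_latent assms(1,2)]) simp
  finally show ?thesis
    using prob_Zev_pos[of z] by (simp add: cexp_def)
qed

section \<open>Potential treatments and the first stage\<close>

text \<open>Irreversibility restricts \<open>potD\<close> under \<open>z\<close> only where the
  instrument equals \<open>z\<close>. A violation is an event of the latent vector, so its
  probability equals its conditional probability given \<open>Zev m z\<close>, which is 0: apply
  \<open>cexp_Zev\<close> with \<open>g = 0\<close>.\<close>

lemma AE_potD_mono: "AE \<omega> in pspace m. potD m 1 z \<omega> \<longrightarrow> potD m 2 z \<omega>"
proof -
  define h :: "real \<times> real \<times> real \<times> real \<times> real \<times> bool \<times> bool \<times> bool \<times> bool \<Rightarrow> real" where
    "h = (\<lambda>(a,b,c,d,e,p,q,r,s). of_bool ((if z then p else q) \<and> \<not> (if z then r else s)))"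
  let ?B = "{\<omega> \<in> space (pspace m). potD m 1 z \<omega> \<and> \<not> potD m 2 z \<omega>}"
  have h_latent: "h (latent \<omega>) = of_bool (potD m 1 z \<omega> \<and> \<not> potD m 2 z \<omega>)" for \<omega>
    by (simp add: h_def latent_def)
  have [measurable]: "h \<in> borel_measurable latent_space"
    unfolding h_def by measurable
  have int: "integrable (pspace m) (\<lambda>\<omega>. h (latent \<omega>))"
    by (rule integrable_const_bound[of _ 1]) (auto simp: h_latent)
  have "AE \<omega> in pspace m. \<omega> \<in> Zev m z \<longrightarrow> 0 = h (latent \<omega>)"
    using irrev unfolding irreversible_def
    by eventually_elim (auto simp: h_latent obsD_def Zev_def)
  then have "cexp m (\<lambda>_. 0) (Zev m z) = expectation (\<lambda>\<omega>. h (latent \<omega>))"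
    by (intro cexp_Zev int) auto
  moreover have "expectation (\<lambda>\<omega>. h (latent \<omega>)) = expectation (indicator ?B)"
    by (intro Bochner_Integration.integral_cong) (auto simp: h_latent)
  moreover have "cexp m (\<lambda>_. 0) (Zev m z) = 0"
    by (simp add: cexp_def set_lebesgue_integral_def)
  ultimately have "prob ?B = 0" by (simp add: Int_absorb1)
  then have "AE \<omega> in pspace m. \<omega> \<notin> ?B"
    by (subst (asm) prob_eq_0) auto
  then show ?thesis by (auto elim!: eventually_mono)
qed

lemma AE_no_defiers: "AE \<omega> in pspace m. potD m 1 False \<omega> \<longrightarrow> potD m 1 True \<omega>"
proof -
  have "AE \<omega> in pspace m. \<omega> \<notin> DF m 1"
    using mono by (subst (asm) prob_eq_0) auto
  then show ?thesis by (auto simp: DF_def elim!: eventually_mono)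
qed

lemma cexp_obsD:
  assumes "t \<in> {1, 2}"
  shows "cexp m (\<lambda>\<omega>. of_bool (obsD m t \<omega>)) (Zev m z) = expectation (\<lambda>\<omega>. of_bool (potD m t z \<omega>))"
proof -
  define h :: "real \<times> real \<times> real \<times> real \<times> real \<times> bool \<times> bool \<times> bool \<times> bool \<Rightarrow> real" where
    "h = (\<lambda>(a,b,c,d,e,p,q,r,s).
       of_bool (if t = 1 then if z then p else q else if z then r else s))"
  have h_latent: "h (latent \<omega>) = of_bool (potD m t z \<omega>)" for \<omega>
    using assms by (auto simp: h_def latent_def)
  have [measurable]: "h \<in> borel_measurable latent_space"
    unfolding h_def by measurable
  have [measurable]: "potD m t z' \<in> measurable (pspace m) (count_space UNIV)" for z'
    using assms by auto
  \<comment> \<open>A case distinction on the instrument replaces the random index in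
    \<open>obsD\<close>, so that measurability can be derived.\<close>
  have "(\<lambda>\<omega>. of_bool (obsD m t \<omega>) :: real) =
      (\<lambda>\<omega>. of_bool (if instr m \<omega> then potD m t True \<omega> else potD m t False \<omega>))"
    by (auto simp: obsD_def fun_eq_iff)
  also have "\<dots> \<in> borel_measurable (pspace m)"
    by measurable
  finally have [measurable]: "(\<lambda>\<omega>. of_bool (obsD m t \<omega>) :: real) \<in> borel_measurable (pspace m)" .
  have "integrable (pspace m) (\<lambda>\<omega>. h (latent \<omega>))"
    by (rule integrable_const_bound[of _ 1]) (auto simp: h_latent)
  then have "cexp m (\<lambda>\<omega>. of_bool (obsD m t \<omega>)) (Zev m z) = expectation (\<lambda>\<omega>. h (latent \<omega>))"
    by (intro cexp_Zev) (auto simp: h_latent obsD_def Zev_def)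
  then show ?thesis by (simp add: h_latent)
qed

lemma integrable_potD:
  assumes "t \<in> {1, 2}"
  shows "integrable (pspace m) (\<lambda>\<omega>. of_bool (potD m t z \<omega>) :: real)"
proof -
  have [measurable]: "potD m t z \<in> measurable (pspace m) (count_space UNIV)"
    using assms by auto
  show ?thesis
    by (rule integrable_const_bound[of _ 1]) auto
qed

lemma FS_eq:
  assumes "t \<in> {1, 2}"
  shows "FS m t = expectation (\<lambda>\<omega>. of_bool (potD m t True \<omega>) - of_bool (potD m t False \<omega>))"
  using assms by (simp add: FS_def cexp_obsD integrable_potD)

text \<open>Without defiers the difference of the two potential treatments is 0 or 1, and it is 1
  exactly on the compliers.\<close>

lemma FS_1_eq: "FS m 1 = Pr m (CO m 1)"
proof -
  have "FS m 1 = expectation (\<lambda>\<omega>. of_bool (potD m 1 True \<omega>) - of_bool (potD m 1 False \<omega>))"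
    by (rule FS_eq) simp
  also have "\<dots> = expectation (indicator (CO m 1))"
  proof (rule integral_cong_AE)
    show "AE \<omega> in pspace m. of_bool (potD m 1 True \<omega>) - of_bool (potD m 1 False \<omega>) =
        (indicator (CO m 1) \<omega> :: real)"
      using AE_no_defiers AE_space by eventually_elim (auto simp: CO_def indicator_def)
  qed measurable
  finally show ?thesis by simp
qed

section \<open>Decomposition over latent types\<close>

text \<open>\<open>u\<close>, \<open>v\<close>, \<open>w\<close> stand for Y_2(1,1), Y_2(1,0),
  Y_2(0). They are parameters so that the same decomposition serves the outcome and, with values 1,
  1, 0, the treatment.\<close>

definition by_status :: "('a \<Rightarrow> real) \<Rightarrow> ('a \<Rightarrow> real) \<Rightarrow> ('a \<Rightarrow> real) \<Rightarrow> bool \<Rightarrow> 'a \<Rightarrow> real" where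
  "by_status u v w z \<omega> =
     (if potD m 1 z \<omega> then u \<omega> else if potD m 2 z \<omega> then v \<omega> else w \<omega>)"

lemma measurable_by_status [measurable]:
  assumes [measurable]: "u \<in> borel_measurable (pspace m)" "v \<in> borel_measurable (pspace m)"
    "w \<in> borel_measurable (pspace m)"
  shows "by_status u v w z \<in> borel_measurable (pspace m)"
  unfolding by_status_def[abs_def] by measurable

lemma integrable_by_status:
  assumes "integrable (pspace m) u" "integrable (pspace m) v" "integrable (pspace m) w"
  shows "integrable (pspace m) (by_status u v w z)"
proof -
  have [measurable]: "u \<in> borel_measurable (pspace m)" "v \<in> borel_measurable (pspace m)"
    "w \<in> borel_measurable (pspace m)"
    using assms by auto
  have "integrable (pspace m) (\<lambda>\<omega>. \<bar>u \<omega>\<bar> + \<bar>v \<omega>\<bar> + \<bar>w \<omega>\<bar>)"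
    using assms by simp
  then show ?thesis
    by (rule Bochner_Integration.integrable_bound) (auto simp: by_status_def)
qed

text \<open>On C_1 the value under \<open>True\<close> is \<open>u\<close>, and under
  \<open>False\<close> it is \<open>v\<close> or \<open>w\<close> according to D_2(0).
  Irreversibility gives D_2(1) = 1 there, so the \<open>v\<close> case is AT_2, and
  \<open>u - v\<close> is written as \<open>(u - w) - (v - w)\<close>: this is where the negative
  weight on late treatment comes from.\<close>

lemma AE_by_status_diff:
  "AE \<omega> in pspace m. by_status u v w True \<omega> - by_status u v w False \<omega> =
     indicator (CO m 1) \<omega> * (u \<omega> - w \<omega>)
     - indicator (CO m 1 \<inter> AT m 2) \<omega> * (v \<omega> - w \<omega>)
     - indicator (NT m 1 \<inter> DF m 2) \<omega> * (v \<omega> - w \<omega>)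
     + indicator (NT m 1 \<inter> CO m 2) \<omega> * (v \<omega> - w \<omega>)"
  using AE_no_defiers AE_potD_mono[of True] AE_potD_mono[of False] AE_space
  by eventually_elim
    (auto simp: by_status_def CO_def AT_def NT_def DF_def indicator_def)

lemma expectation_by_status_diff:
  assumes int: "integrable (pspace m) u" "integrable (pspace m) v" "integrable (pspace m) w"
  shows "expectation (by_status u v w True) - expectation (by_status u v w False) =
     (LINT \<omega>:CO m 1|pspace m. u \<omega> - w \<omega>)
     - (LINT \<omega>:CO m 1 \<inter> AT m 2|pspace m. v \<omega> - w \<omega>)
     - (LINT \<omega>:NT m 1 \<inter> DF m 2|pspace m. v \<omega> - w \<omega>)
     + (LINT \<omega>:NT m 1 \<inter> CO m 2|pspace m. v \<omega> - w \<omega>)"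
proof -
  have [measurable]: "u \<in> borel_measurable (pspace m)" "v \<in> borel_measurable (pspace m)"
    "w \<in> borel_measurable (pspace m)"
    using int by auto
  have ind: "integrable (pspace m) (\<lambda>\<omega>. indicator A \<omega> * (x \<omega> - w \<omega>))"
    if "A \<in> events" "integrable (pspace m) x" for A x
    using integrable_mult_indicator[OF that(1), of "\<lambda>\<omega>. x \<omega> - w \<omega>"] that int by simp
  have "expectation (by_status u v w True) - expectation (by_status u v w False) =
      expectation (\<lambda>\<omega>. by_status u v w True \<omega> - by_status u v w False \<omega>)"
    using int by (simp add: integrable_by_status)
  also have "\<dots> = expectation (\<lambda>\<omega>. indicator (CO m 1) \<omega> * (u \<omega> - w \<omega>)
     - indicator (CO m 1 \<inter> AT m 2) \<omega> * (v \<omega> - w \<omega>)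
     - indicator (NT m 1 \<inter> DF m 2) \<omega> * (v \<omega> - w \<omega>)
     + indicator (NT m 1 \<inter> CO m 2) \<omega> * (v \<omega> - w \<omega>))"
    by (intro integral_cong_AE AE_by_status_diff) measurable
  finally show ?thesis
    using int by (simp add: ind set_lebesgue_integral_def)
qed

text \<open>By irreversibility D_2(z) is almost surely \<open>by_status\<close> with values 1, 1, 0.
  Every effect is then 1 and only the weights remain.\<close>

lemma FS_2_eq: "FS m 2 = (\<Sum>e\<in>UNIV. RF_weight m e)"
proof -
  have "expectation (\<lambda>\<omega>. of_bool (potD m 2 z \<omega>)) = expectation (by_status (\<lambda>_. 1) (\<lambda>_. 1) (\<lambda>_. 0) z)"
    for z
  proof (rule integral_cong_AE)
    show "AE \<omega> in pspace m. of_bool (potD m 2 z \<omega>) = by_status (\<lambda>_. 1) (\<lambda>_. 1) (\<lambda>_. 0) z \<omega>"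
      using AE_potD_mono[of z] by eventually_elim (auto simp: by_status_def)
  qed measurable
  then have "FS m 2 = expectation (by_status (\<lambda>_. 1) (\<lambda>_. 1) (\<lambda>_. 0) True)
      - expectation (by_status (\<lambda>_. 1) (\<lambda>_. 1) (\<lambda>_. 0) False)"
    by (simp add: FS_def cexp_obsD)
  then show ?thesis
    by (simp add: expectation_by_status_diff UNIV_effect set_lebesgue_integral_def)
qed

section \<open>Observed outcome and reduced form in period 2\<close>

text \<open>The first treated period is 1 or 2, so the elapsed time
  \<open>2 - (LEAST s. ...)\<close> is 1 or 0. Both sides look at period 1 first, so the identity
  holds at every point.\<close>

lemma obsY_2:
  "obsY m 2 \<omega> =
     by_status (potY1z m 2 1 (instr m \<omega>)) (potY1z m 2 0 (instr m \<omega>)) (potY0z m 2 (instr m \<omega>))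
       (instr m \<omega>) \<omega>"
proof -
  have two: "{Suc 0..2} = {Suc 0, 2}" by auto
  show ?thesis
  proof (cases "obsD m 1 \<omega>")
    case True
    then have "(LEAST s. 1 \<le> s \<and> obsD m s \<omega>) = 1"
      by (intro Least_equality) auto
    with True show ?thesis
      by (auto simp: obsY_def two by_status_def obsD_def)
  next
    case False
    have "(LEAST s. 1 \<le> s \<and> obsD m s \<omega>) = 2" if "obsD m 2 \<omega>"
    proof (rule Least_equality)
      fix s assume "1 \<le> s \<and> obsD m s \<omega>"
      with False show "2 \<le> s" by (cases "s = 1") auto
    qed (use that in auto)
    with False show ?thesis
      by (auto simp: obsY_def two by_status_def obsD_def)
  qed
qed

lemma measurable_obsY_2 [measurable]: "obsY m 2 \<in> borel_measurable (pspace m)"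
proof -
  have "obsY m 2 = (\<lambda>\<omega>. if instr m \<omega>
      then by_status (potY1z m 2 1 True) (potY1z m 2 0 True) (potY0z m 2 True) True \<omega>
      else by_status (potY1z m 2 1 False) (potY1z m 2 0 False) (potY0z m 2 False) False \<omega>)"
    by (auto simp: fun_eq_iff obsY_2)
  also have "\<dots> \<in> borel_measurable (pspace m)"
    by measurable
  finally show ?thesis .
qed

lemma cexp_obsY_2:
  "cexp m (obsY m 2) (Zev m z) = expectation (by_status (potY1 m 2 1) (potY1 m 2 0) (potY0 m 2) z)"
proof -
  define h :: "real \<times> real \<times> real \<times> real \<times> real \<times> bool \<times> bool \<times> bool \<times> bool \<Rightarrow> real" where
    "h = (\<lambda>(a,b,c,d,e,p,q,r,s).
       if (if z then p else q) then e else if (if z then r else s) then d else c)"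
  have h_latent: "(\<lambda>\<omega>. h (latent \<omega>)) = by_status (potY1 m 2 1) (potY1 m 2 0) (potY0 m 2) z"
    by (auto simp: h_def latent_def by_status_def fun_eq_iff)
  have [measurable]: "h \<in> borel_measurable latent_space"
    unfolding h_def by measurable
  have "AE \<omega> in pspace m. \<omega> \<in> Zev m z \<longrightarrow> obsY m 2 \<omega> = h (latent \<omega>)"
    using AE_exclusion[of z]
    by eventually_elim (auto simp: h_def latent_def by_status_def obsY_2 Zev_def)
  then have "cexp m (obsY m 2) (Zev m z) = expectation (\<lambda>\<omega>. h (latent \<omega>))"
    \<comment> \<open>With \<open>One_nat_def\<close> active, \<open>potY1 m 2 1\<close> would
      become \<open>potY1 m 2 (Suc 0)\<close> and no longer match
      \<open>integrable_pot\<close>.\<close>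
    by (intro cexp_Zev) (auto simp del: One_nat_def simp: h_latent intro!: integrable_by_status integrable_pot)
  then show ?thesis by (simp only: h_latent)
qed

text \<open>The four set integrals of \<open>expectation_by_status_diff\<close> are weight times
  effect by \<open>measure_times_cexp\<close>, null types included.\<close>

lemma RF_2_eq: "RF m 2 = (\<Sum>e\<in>UNIV. RF_weight m e * causal_effect m e)"
  unfolding RF_def cexp_obsY_2
  by (subst expectation_by_status_diff)
     (auto simp del: One_nat_def simp: integrable_pot UNIV_effect \<Delta>_def measure_times_cexp prob_space_axioms)

end

section \<open>Weights of the ratio and their signs\<close>

lemma iv_assumptions_iff: "iv_assumptions m \<longleftrightarrow> iv m \<and> FS m 1 \<noteq> 0"
  by (auto simp: iv_assumptions_def iv_def)

lemma Wald_weights: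
  assumes "iv_assumptions m" "FS m 2 \<noteq> 0"
  shows "RF m 2 / FS m 2 = (\<Sum>e\<in>UNIV. Wald_weight m e * causal_effect m e)"
    and "(\<Sum>e\<in>UNIV. Wald_weight m e) = 1"
    and "FS m 2 < FS m 1 \<Longrightarrow> \<exists>e. Wald_weight m e < 0"
    and "{e. Wald_weight m e < 0} = {e. RF_weight m e < 0} \<longleftrightarrow> FS m 2 > 0"
proof -
  interpret iv m using assms by (simp add: iv_assumptions_iff)
  \<comment> \<open>Relevance makes P(C_1) = FS_1 nonzero. The ratio weight of \<open>Eff_C1\<close>
    therefore has the sign of FS_2.\<close>
  have pos: "0 < RF_weight m Eff_C1"
    using assms FS_1_eq by (simp add: iv_assumptions_def less_le)
  show "RF m 2 / FS m 2 = (\<Sum>e\<in>UNIV. Wald_weight m e * causal_effect m e)"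
    by (simp add: RF_2_eq Wald_weight_def sum_divide_distrib)
  show "(\<Sum>e\<in>UNIV. Wald_weight m e) = 1"
    using assms(2) by (simp add: Wald_weight_def FS_2_eq flip: sum_divide_distrib)
  show "\<exists>e. Wald_weight m e < 0" if "FS m 2 < FS m 1"
  proof (cases "FS m 2 < 0")
    case True
    with pos show ?thesis
      by (intro exI[of _ Eff_C1]) (simp add: Wald_weight_def divide_pos_neg)
  next
    case False
    have "0 \<le> RF_weight m Eff_NT1_C2" by simp
    \<comment> \<open>This sum is FS_2 - FS_1, since FS_1 is the remaining weight P(C_1). Its last
      term is nonnegative, so one of the other two is strictly negative, and here FS_2 > 0 keeps
      that sign.\<close>
    moreover have "RF_weight m Eff_C1_AT2 + RF_weight m Eff_NT1_F2 + RF_weight m Eff_NT1_C2 < 0"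
      using that unfolding FS_2_eq FS_1_eq by (simp add: UNIV_effect)
    ultimately have "RF_weight m Eff_C1_AT2 < 0 \<or> RF_weight m Eff_NT1_F2 < 0"
      by linarith
    with False assms(2) show ?thesis
      unfolding Wald_weight_def
      by (auto simp: divide_less_0_iff simp del: RF_weight.simps)
  qed
  show "{e. Wald_weight m e < 0} = {e. RF_weight m e < 0} \<longleftrightarrow> FS m 2 > 0"
  proof
    \<comment> \<open>The label \<open>Eff_C1\<close> alone decides: its weight in RF_2 is positive,
      so a common sign pattern excludes FS_2 < 0.\<close>
    assume eq: "{e. Wald_weight m e < 0} = {e. RF_weight m e < 0}"
    then have "\<not> Wald_weight m Eff_C1 < 0" using pos by (auto simp: set_eq_iff)
    with pos assms(2) show "FS m 2 > 0"
      by (simp add: Wald_weight_def divide_less_0_iff)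
  qed (auto simp: Wald_weight_def divide_less_0_iff)
qed

section \<open>A model with a negative weight\<close>

text \<open>Four equally likely points carry two independent fair bits: parity, used as the
  instrument, and \<open>\<omega> < 2\<close>, used as D_2(0).\<close>

definition four_points :: "nat pmf" where
  "four_points = pmf_of_set {0, 1, 2, 3}"

text \<open>Everybody is a complier in period 1, and half of the units would be treated in period 2
  in any case.\<close>

definition example_model :: "nat iv_model" where
  "example_model = \<lparr>pspace = measure_pmf four_points, instr = even,
     potD = (\<lambda>t z \<omega>. z \<or> t = 2 \<and> \<omega> < 2),
     potY0z = (\<lambda>_ _ _. 0), potY1z = (\<lambda>_ _ _ _. 0), potY0 = (\<lambda>_ _. 0), potY1 = (\<lambda>_ _ _. 0)\<rparr>"

lemma measure_four_points:
  "measure (measure_pmf four_points) A =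
     (of_bool (0 \<in> A) + of_bool (1 \<in> A) + of_bool (2 \<in> A) + of_bool (3 \<in> A)) / 4"
proof -
  have "measure (measure_pmf four_points) A = (LINT \<omega>|measure_pmf four_points. indicator A \<omega>)"
    by simp
  also have "\<dots> = (\<Sum>\<omega>\<in>{0, 1, 2, 3}. indicator A \<omega>) / 4"
    unfolding four_points_def by (subst integral_pmf_of_set) auto
  finally show ?thesis by (simp add: indicator_def)
qed

lemma indep_rv_four_points:
  assumes "\<And>x. g x \<in> space S"
  shows "indep_rv (measure_pmf four_points) S (\<lambda>\<omega>. g (\<omega> < 2)) (count_space UNIV) even"
  unfolding indep_rv_def
proof (intro conjI prob_space.indep_setI[OF measure_pmf.prob_space_axioms])
  fix a b assume "a \<in> {(\<lambda>\<omega>. g (\<omega> < 2)) -` A \<inter> space (measure_pmf four_points) |A. A \<in> sets S}"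
    "b \<in> {even -` B \<inter> space (measure_pmf four_points) |B. B \<in> sets (count_space UNIV)}"
  then obtain A B where ab: "a = (\<lambda>\<omega>. g (\<omega> < 2)) -` A" "b = even -` B" by auto
  show "measure_pmf.prob four_points (a \<inter> b) = measure_pmf.prob four_points a * measure_pmf.prob four_points b"
    unfolding ab measure_four_points
    \<comment> \<open>Both preimages are determined by these four memberships, which leaves finitely
      many numerical identities.\<close>
    by (cases "g True \<in> A"; cases "g False \<in> A"; cases "True \<in> B"; cases "False \<in> B") simp_all
qed (use assms in auto)

lemma iv_example_model: "iv example_model"
proof
  have Zev: "Zev example_model True = {\<omega>. even \<omega>}"
    by (auto simp: Zev_def example_model_def)
  have "pspace example_model = measure_pmf four_points"
    by (simp add: example_model_def)
  then show "iv_setting example_model"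
    unfolding iv_setting_def Zev
    by (auto simp: measure_four_points example_model_def measure_pmf.prob_space_axioms)
  show "irreversible example_model"
    by (simp add: irreversible_def example_model_def obsD_def)
  show "exclusion example_model"
    by (simp add: exclusion_def example_model_def)
  show "independence example_model"
    unfolding independence_def
    \<comment> \<open>In the latent vector only the last component D_2(0) varies, and it is the bit
      \<open>\<omega> < 2\<close>.\<close>
    by (simp add: example_model_def,
        rule indep_rv_four_points[where g = "\<lambda>b. (0, 0, 0, 0, 0, True, False, True, b)"])
       (simp add: space_pair_measure)
  have "DF example_model 1 = {}"
    by (auto simp: DF_def example_model_def)
  then show "Pr example_model (DF example_model 1) = 0" by simp
qed

lemma example_model_weights:
  "RF_weight example_model Eff_C1 = 1" "RF_weight example_model Eff_C1_AT2 = - 1 / 2"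
  "RF_weight example_model Eff_NT1_F2 = 0" "RF_weight example_model Eff_NT1_C2 = 0"
  by (simp_all add: example_model_def CO_def AT_def NT_def DF_def measure_four_points)

text \<open>Here FS_1 = 1 and FS_2 = 1 - 1/2, so the ratio puts weight 2 on \<open>Eff_C1\<close>
  and -1 on \<open>Eff_C1_AT2\<close>.\<close>

lemma example_model:
  "iv_assumptions example_model" "FS example_model 2 \<noteq> 0"
  "Wald_weight example_model Eff_C1_AT2 < 0"
proof -
  interpret iv example_model by (rule iv_example_model)
  show "iv_assumptions example_model"
    using iv_example_model FS_1_eq example_model_weights by (simp add: iv_assumptions_iff)
  have "FS example_model 2 = 1 / 2"
    by (simp only: FS_2_eq UNIV_effect) (simp add: example_model_weights del: RF_weight.simps)
  then show "FS example_model 2 \<noteq> 0" "Wald_weight example_model Eff_C1_AT2 < 0"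
    by (simp_all add: Wald_weight_def example_model_weights del: RF_weight.simps)
qed

text \<open>That weights may be negative is rendered as an existence claim, witnessed on the
  concrete sample space type \<open>nat\<close>, while the decomposition is stated for every
  \<open>'a\<close>.\<close>

theorem corollary2p1:
  shows "(\<forall>m :: 'a iv_model. iv_assumptions m \<and> FS m 2 \<noteq> 0 \<longrightarrow>
            RF m 2 / FS m 2 = (\<Sum>e\<in>UNIV. Wald_weight m e * causal_effect m e) \<and>
            (\<Sum>e\<in>UNIV. Wald_weight m e) = 1 \<and>
            (FS m 2 < FS m 1 \<longrightarrow> (\<exists>e. Wald_weight m e < 0)) \<and>
            RF m 2 = (\<Sum>e\<in>UNIV. RF_weight m e * causal_effect m e) \<and>
            ({e. Wald_weight m e < 0} = {e. RF_weight m e < 0} \<longleftrightarrow> FS m 2 > 0))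
       \<and> (\<exists>m :: nat iv_model. iv_assumptions m \<and> FS m 2 \<noteq> 0 \<and> (\<exists>e. Wald_weight m e < 0))"
proof (intro conjI allI impI)
  show "\<exists>m :: nat iv_model. iv_assumptions m \<and> FS m 2 \<noteq> 0 \<and> (\<exists>e. Wald_weight m e < 0)"
    using example_model by blast
next
  fix m :: "'a iv_model"
  assume m: "iv_assumptions m \<and> FS m 2 \<noteq> 0"
  then show "RF m 2 = (\<Sum>e\<in>UNIV. RF_weight m e * causal_effect m e)"
    using iv.RF_2_eq[of m] by (simp only: iv_assumptions_iff)
qed (use Wald_weights in blast)+

end
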